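(* Let $m\ge n\ge 1$ be integers, let $A\in\mathbb{R}^{m\times m}$ and $B\in\mathbb{R}^{n\times n}$ be symmetric matrices, and let $\rho>0$. Let $F(X)=\mathrm{tr}(X^TAXB)$, and let $\mathcal{X}\subset \mathrm{St}(m,n)$ be the set of critical points of $F$ on $\mathrm{St}(m,n)$. Then there exist constants $\delta,\eta>0$ such that for all $X\in \mathrm{St}(m,n)$ and all $X^*\in\mathcal{X}$ with $\|X-X^*\|_F\le\delta$, $$|F(X)-F(X^* )|^{1/2}\le \eta\,\|D_\rho(X)\|_F .$$
   Context: $\mathrm{St}(m,n)=\{X\in\mathbb{R}^{m\times n} : X^TX=I_n\}$ is the Stiefel manifold, viewed as an embedded submanifold of $\mathbb{R}^{m\times n}$ with the inherited metric $\langle X,Y\rangle=\mathrm{tr}(X^TY)$; $\|\cdot\|_F$ is the Frobenius norm. The Euclidean gradient of $F$ is $\nabla F(X)=2AXB$. For $X\in \mathrm{St}(m,n)$, the orthogonal projection of $\nabla F(X)$ onto the tangent space $\{Y\in\mathbb{R}^{m\times n}: X^TY+Y^TX=0\}$ is $$\mathrm{grad}\,F(X)=2AXB-XX^TAXB-XBX^TAX,$$ and the set of critical points is $\mathcal{X}=\{X\in \mathrm{St}(m,n): \mathrm{grad}\,F(X)=0\}$. For $\rho>0$, $$D_\rho(X)=\nabla F(X)-X\left(2\rho\,\nabla F(X)^TX+(1-2\rho)X^T\nabla F(X)\right).$$ *)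

theory Defs
  imports "HOL-Analysis.Analysis"
begin

text \<open>
  An \<open>m \<times> n\<close> real matrix has type \<^typ>\<open>real^'n^'m\<close>, with \<open>m = CARD('m)\<close> and \<open>n = CARD('n)\<close>.
  The library's inner product and norm on this type are \<open>tr (X\<^sup>T Y)\<close> and the Frobenius norm.
\<close>

lemma inner_eq_trace:
  fixes X Y :: "real^'n^'m"
  shows "X \<bullet> Y = trace (transpose X ** Y)"
  unfolding inner_vec_def trace_def matrix_matrix_mult_def transpose_def
  by (simp, rule sum.swap)

lemma norm_eq_frobenius:
  fixes X :: "real^'n^'m"
  shows "norm X = sqrt (\<Sum>i\<in>UNIV. \<Sum>j\<in>UNIV. (X $ i $ j)\<^sup>2)"
  unfolding norm_eq_sqrt_inner inner_vec_def by (simp add: power2_eq_square)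

definition stiefel :: "(real^'n^'m) set"
  where "stiefel = {X. transpose X ** X = mat 1}"

definition stiefel_tangent :: "real^'n^'m \<Rightarrow> (real^'n^'m) set"
  where "stiefel_tangent X = {Y. transpose X ** Y + transpose Y ** X = 0}"

definition euclidean_grad :: "(real^'n^'m \<Rightarrow> real) \<Rightarrow> real^'n^'m \<Rightarrow> real^'n^'m"
  where "euclidean_grad f X = (THE G. GDERIV f X :> G)"

text \<open>On a closed subspace, \<^const>\<open>closest_point\<close> is the orthogonal projection.\<close>

definition stiefel_grad :: "(real^'n^'m \<Rightarrow> real) \<Rightarrow> real^'n^'m \<Rightarrow> real^'n^'m"
  where "stiefel_grad f X = closest_point (stiefel_tangent X) (euclidean_grad f X)"

definition critical_points :: "(real^'n^'m \<Rightarrow> real) \<Rightarrow> (real^'n^'m) set"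
  where "critical_points f = {X \<in> stiefel. stiefel_grad f X = 0}"

definition D_map :: "(real^'n^'m \<Rightarrow> real) \<Rightarrow> real \<Rightarrow> real^'n^'m \<Rightarrow> real^'n^'m"
  where "D_map f \<rho> X =
    euclidean_grad f X
      - X ** ((2 * \<rho>) *\<^sub>R (transpose (euclidean_grad f X) ** X)
              + (1 - 2 * \<rho>) *\<^sub>R (transpose X ** euclidean_grad f X))"

definition quad_trace :: "real^'m^'m \<Rightarrow> real^'n^'n \<Rightarrow> real^'n^'m \<Rightarrow> real"
  where "quad_trace A B X = trace (transpose X ** A ** X ** B)"

lemma transpose_add: "transpose (X + Y) = transpose X + transpose (Y :: real^'n^'m)"
  by (simp add: transpose_def vec_eq_iff)

lemma transpose_minus: "transpose (X - Y) = transpose X - transpose (Y :: real^'n^'m)"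
  by (simp add: transpose_def vec_eq_iff)

lemma transpose_scaleR: "transpose (c *\<^sub>R X) = c *\<^sub>R transpose (X :: real^'n^'m)"
  by (simp add: transpose_def vec_eq_iff)

lemma matrix_mult_scaleR:
  fixes X :: "real^'k^'m" and Y :: "real^'n^'k"
  shows "(c *\<^sub>R X) ** Y = c *\<^sub>R (X ** Y)" "X ** (c *\<^sub>R Y) = c *\<^sub>R (X ** Y)"
  by (simp_all add: matrix_matrix_mult_def vec_eq_iff sum_distrib_left mult_ac)

lemma matrix_mult_diff:
  fixes X X' :: "real^'k^'m" and Y Y' :: "real^'n^'k"
  shows "(X - X') ** Y = X ** Y - X' ** Y" "X ** (Y - Y') = X ** Y - X ** Y'"
  by (simp_all add: matrix_matrix_mult_def vec_eq_iff sum_subtractf algebra_simps)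

lemma matrix_mult_add:
  fixes X X' :: "real^'k^'m" and Y Y' :: "real^'n^'k"
  shows "(X + X') ** Y = X ** Y + X' ** Y" "X ** (Y + Y') = X ** Y + X ** Y'"
  by (simp_all add: matrix_matrix_mult_def vec_eq_iff sum.distrib algebra_simps)

lemmas matrix_algebra = matrix_mult_scaleR matrix_mult_diff matrix_mult_add transpose_add transpose_minus transpose_scaleR matrix_transpose_mul

lemma euclidean_grad_eqI:
  assumes "GDERIV f X :> G"
  shows "euclidean_grad f X = G"
  unfolding euclidean_grad_def
proof (rule the_equality)
  show "GDERIV f X :> G" by (rule assms)
next
  fix H assume "GDERIV f X :> H"
  then have "(\<lambda>h. h \<bullet> H) = (\<lambda>h. h \<bullet> G)"
    using assms unfolding gderiv_def by (rule has_derivative_unique)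
  then show "H = G"
    by (metis vector_eq_rdot inner_commute)
qed

lemma inner_sandwich_swap:
  fixes A :: "real^'m^'m" and B :: "real^'n^'n" and X Y :: "real^'n^'m"
  assumes "transpose A = A" "transpose B = B"
  shows "X \<bullet> (A ** Y ** B) = Y \<bullet> (A ** X ** B)"
proof -
  have "X \<bullet> (A ** Y ** B) = trace (transpose (A ** Y ** B) ** X)"
    by (metis inner_commute inner_eq_trace)
  also have "\<dots> = trace (B ** (transpose Y ** A ** X))"
    using assms by (simp add: matrix_transpose_mul matrix_mul_assoc)
  also have "\<dots> = trace (transpose Y ** (A ** X ** B))"
    by (subst trace_mul_sym) (simp add: matrix_mul_assoc)
  finally show ?thesis by (simp add: inner_eq_trace)
qed

lemma euclidean_grad_quad_trace:
  fixes A :: "real^'m^'m" and B :: "real^'n^'n" and X :: "real^'n^'m"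
  assumes "transpose A = A" "transpose B = B"
  shows "euclidean_grad (quad_trace A B) X = 2 *\<^sub>R (A ** X ** B)"
proof (rule euclidean_grad_eqI)
  have "linear (\<lambda>X :: real^'n^'m. A ** X ** B)"
    by (rule linearI) (simp_all add: matrix_algebra)
  then have "((\<lambda>X. A ** X ** B) has_derivative (\<lambda>h. A ** h ** B)) (at X)"
    by (rule linear_imp_has_derivative)
  then have "((\<lambda>X. X \<bullet> (A ** X ** B)) has_derivative
               (\<lambda>h. X \<bullet> (A ** h ** B) + h \<bullet> (A ** X ** B))) (at X)"
    by (intro has_derivative_inner has_derivative_ident)
  moreover have "(\<lambda>h. X \<bullet> (A ** h ** B) + h \<bullet> (A ** X ** B)) = (\<lambda>h. h \<bullet> (2 *\<^sub>R (A ** X ** B)))"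
    using inner_sandwich_swap[OF assms] by auto
  moreover have "quad_trace A B = (\<lambda>X. X \<bullet> (A ** X ** B))"
    by (simp add: fun_eq_iff quad_trace_def inner_eq_trace matrix_mul_assoc)
  ultimately show "GDERIV (quad_trace A B) X :> 2 *\<^sub>R (A ** X ** B)"
    by (simp add: gderiv_def)
qed

lemma subspace_stiefel_tangent: "subspace (stiefel_tangent X)"
proof -
  have "linear (\<lambda>Y. transpose X ** Y + transpose Y ** X)"
    by (rule linearI) (simp_all add: matrix_algebra algebra_simps)
  then show ?thesis
    unfolding stiefel_tangent_def by (rule linear_subspace_kernel)
qed

lemma closest_point_subspace_eqI:
  fixes S :: "'a::euclidean_space set"
  assumes "subspace S" "p \<in> S" and ortho: "\<And>y. y \<in> S \<Longrightarrow> (a - p) \<bullet> y = 0"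
  shows "closest_point S a = p"
proof -
  have "dist a p \<le> dist a z" if "z \<in> S" for z
  proof -
    have "(a - p) \<bullet> (p - z) = 0"
      using assms that by (intro ortho subspace_diff)
    then have "(norm ((a - p) + (p - z)))\<^sup>2 = (norm (a - p))\<^sup>2 + (norm (p - z))\<^sup>2"
      by (intro norm_add_Pythagorean) (simp add: orthogonal_def)
    then have "(norm (a - p))\<^sup>2 \<le> (norm (a - z))\<^sup>2" by simp
    then show ?thesis by (simp add: dist_norm)
  qed
  then show ?thesis
    using closest_point_unique[of S p a] assms
    by (simp add: subspace_imp_convex closed_subspace)
qed

lemma stiefel_grad_quad_trace:
  fixes A :: "real^'m^'m" and B :: "real^'n^'n" and X :: "real^'n^'m"
  assumes "transpose A = A" "transpose B = B" and X: "X \<in> stiefel"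
  shows "stiefel_grad (quad_trace A B) X =
    2 *\<^sub>R (A ** X ** B) - X ** transpose X ** A ** X ** B - X ** B ** transpose X ** A ** X"
    (is "_ = ?P")
proof -
  define S where "S = transpose X ** A ** X ** B + B ** transpose X ** A ** X"
  have symS: "transpose S = S"
    using assms by (simp add: S_def matrix_algebra matrix_mul_assoc add.commute)
  have P: "?P = 2 *\<^sub>R (A ** X ** B) - X ** S"
    by (simp add: S_def matrix_algebra matrix_mul_assoc)
  have XX: "transpose X ** X = mat 1" using X by (simp add: stiefel_def)
  have XXS: "transpose X ** (X ** S) = S"
    by (simp add: matrix_mul_assoc XX)
  have "transpose X ** ?P = 2 *\<^sub>R (transpose X ** A ** X ** B) - S"
    unfolding P matrix_mult_diff XXS by (simp add: matrix_algebra matrix_mul_assoc)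
  moreover have "transpose ?P ** X = 2 *\<^sub>R (B ** transpose X ** A ** X) - S"
  proof -
    have "transpose ?P ** X = transpose (transpose X ** ?P)"
      by (simp add: matrix_transpose_mul)
    also have "\<dots> = transpose (2 *\<^sub>R (transpose X ** A ** X ** B) - S)"
      using \<open>transpose X ** ?P = _\<close> by simp
    also have "\<dots> = 2 *\<^sub>R (B ** transpose X ** A ** X) - S"
      using assms symS by (simp add: matrix_algebra matrix_mul_assoc)
    finally show ?thesis .
  qed
  ultimately have "?P \<in> stiefel_tangent X"
    by (simp add: stiefel_tangent_def S_def scaleR_2)
  moreover have "(2 *\<^sub>R (A ** X ** B) - ?P) \<bullet> Y = 0" if "Y \<in> stiefel_tangent X" for Y
  proof -
    have skew: "transpose Y ** X = - (transpose X ** Y)"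
      using that by (simp add: stiefel_tangent_def eq_neg_iff_add_eq_0 add.commute)
    have "(X ** S) \<bullet> Y = trace (S ** (transpose X ** Y))"
      by (simp add: inner_eq_trace matrix_transpose_mul symS matrix_mul_assoc)
    moreover have "(X ** S) \<bullet> Y = trace (transpose Y ** X ** S)"
      by (metis inner_commute inner_eq_trace matrix_mul_assoc)
    moreover have "trace (transpose Y ** X ** S) = trace (S ** - (transpose X ** Y))"
      by (subst trace_mul_sym) (simp add: skew)
    moreover have "S ** - (transpose X ** Y) = - (S ** (transpose X ** Y))"
      using matrix_mult_scaleR(2)[of S "-1" "transpose X ** Y"] by simp
    moreover have "trace (- (S ** (transpose X ** Y))) = - trace (S ** (transpose X ** Y))"
      by (simp add: trace_def sum_negf)
    ultimately have "(X ** S) \<bullet> Y = 0" by (smt (verit))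
    then show ?thesis by (simp add: P)
  qed
  ultimately show ?thesis
    unfolding stiefel_grad_def euclidean_grad_quad_trace[OF assms(1,2)]
    by (intro closest_point_subspace_eqI subspace_stiefel_tangent)
qed

end

theory Submission
  imports Defs
begin

text \<open>
  The function is rewritten in terms of the symmetric matrix \<open>K = X B X\<^sup>T\<close>. On the Stiefel manifold
  the nonzero spectrum of \<open>K\<close> is that of \<open>B\<close>, and \<open>F(X) = tr (A K)\<close>. The residual \<open>D\<^sub>\<rho>(X)\<close> controls
  the commutator \<open>[A, K]\<close> (\<open>norm_commutator_le_D_map\<close>), and \<open>[A, K] = 0\<close> at a critical point
  (\<open>commutator_critical_point\<close>). It remains to see that the value of \<open>tr (A K)\<close> near a critical
  point moves only quadratically in \<open>[A, K]\<close>.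

  Write \<open>A = \<Sum> a P\<^sub>a\<close> and \<open>B = \<Sum> b V\<^sub>b\<close> with spectral projections. Then
  \<open>F(X) = \<Sum> a b tr (P\<^sub>a X V\<^sub>b X\<^sup>T)\<close>, so it suffices to treat each weight \<open>tr (P\<^sub>a W\<^sub>b)\<close> with
  \<open>W\<^sub>b = X V\<^sub>b X\<^sup>T\<close> and \<open>b \<noteq> 0\<close>. Here \<open>W\<^sub>b\<close> is the spectral projection of \<open>K\<close> for \<open>b\<close>, and two
  projections that commute have \<open>tr (P W) = rank (P W)\<close>, an integer. Quantitatively, the distance of
  \<open>tr (P W)\<close> to the integers is at most \<open>\<parallel>[P, W]\<parallel>\<^sup>2\<close> (\<open>projections_trace_near_integer\<close>): this is
  where the square comes from. Passing from a matrix to one of its spectral projections costs only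
  a constant factor in the commutator (\<open>norm_commutator_spectral_projection_le\<close>), because
  \<open>[P, Z] = - P [A, Z] S - S [A, Z] P\<close> with the reduced resolvent \<open>S\<close> of \<open>A\<close>. Applied once to \<open>A\<close>
  and once to \<open>K\<close>, this puts every weight within a constant times \<open>\<parallel>[A, K]\<parallel>\<^sup>2\<close> of some integer,
  uniformly over the whole manifold.

  At a critical point the weights are integers exactly. The weights are Lipschitz, so
  within a uniform distance of a critical point they move by at most \<open>1/2\<close>; a weight then
  has either that same integer as its approximation, or an approximation error at least as large as
  its displacement. In both cases the displacement is at most a constant times \<open>\<parallel>[A, K]\<parallel>\<^sup>2\<close>, hence
  at most a constant times \<open>\<parallel>D\<^sub>\<rho>(X)\<parallel>\<^sup>2\<close>.
\<close>

section \<open>Frobenius norm of products\<close>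

lemma norm_matrix_mult_le:
  fixes A :: "real^'k^'m" and B :: "real^'n^'k"
  shows "norm (A ** B) \<le> norm A * norm B"
proof -
  have "(norm (A ** B))\<^sup>2 = (\<Sum>i\<in>UNIV. \<Sum>j\<in>UNIV. (\<Sum>k\<in>UNIV. A $ i $ k * B $ k $ j)\<^sup>2)"
    by (simp add: norm_eq_frobenius sum_nonneg matrix_matrix_mult_def)
  also have "\<dots> \<le> (\<Sum>i\<in>UNIV. \<Sum>j\<in>UNIV. (\<Sum>k\<in>UNIV. (A $ i $ k)\<^sup>2) * (\<Sum>k\<in>UNIV. (B $ k $ j)\<^sup>2))"
    by (intro sum_mono Cauchy_Schwarz_ineq_sum)
  also have "\<dots> = (\<Sum>i\<in>UNIV. \<Sum>k\<in>UNIV. (A $ i $ k)\<^sup>2) * (\<Sum>j\<in>UNIV. \<Sum>k\<in>UNIV. (B $ k $ j)\<^sup>2)"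
    by (simp add: sum_product)
  also have "(\<Sum>j\<in>UNIV. \<Sum>k\<in>UNIV. (B $ k $ j)\<^sup>2) = (\<Sum>k\<in>UNIV. \<Sum>j\<in>UNIV. (B $ k $ j)\<^sup>2)"
    by (rule sum.swap)
  also have "(\<Sum>i\<in>UNIV. \<Sum>k\<in>UNIV. (A $ i $ k)\<^sup>2) * \<dots> = (norm A * norm B)\<^sup>2"
    by (simp add: norm_eq_frobenius sum_nonneg power_mult_distrib)
  finally show ?thesis
    by (rule power2_le_imp_le) simp
qed

lemma norm_matrix_mult3_le:
  fixes A :: "real^'k^'m" and B :: "real^'l^'k" and C :: "real^'n^'l"
  shows "norm (A ** B ** C) \<le> norm A * norm B * norm C"
  using norm_matrix_mult_le[of "A ** B" C] mult_right_mono[OF norm_matrix_mult_le[of A B], of "norm C"]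
  by simp

lemma norm_transpose: "norm (transpose A) = norm (A :: real^'n^'m)"
  unfolding norm_eq_frobenius transpose_def by (simp, rule sum.swap)

section \<open>Spectral decomposition of symmetric matrices\<close>

lemma symmetric_matrix_inner:
  fixes A :: "real^'m^'m"
  assumes "transpose A = A"
  shows "(A *v x) \<bullet> y = x \<bullet> (A *v y)"
  by (metis assms dot_lmul_matrix vector_transpose_matrix)

text \<open>
  On \<open>W\<close> the quadratic form \<open>a \<parallel>x\<parallel>\<^sup>2 - x \<bullet> A x\<close> is nonnegative and vanishes at \<open>u\<close>, so its
  first variation at \<open>u\<close> vanishes along every direction of \<open>W\<close>. The residual \<open>a u - A u\<close> lies
  in \<open>W\<close>; varying along it gives that it is orthogonal to itself.
\<close>

lemma rayleigh_maximiser_eigenvector: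
  fixes A :: "real^'m^'m"
  assumes sym: "transpose A = A" and W: "subspace W" and u: "u \<in> W"
    and inv: "A *v u \<in> W"
    and max: "\<And>x. x \<in> W \<Longrightarrow> x \<bullet> (A *v x) \<le> a * (x \<bullet> x)"
    and eq: "u \<bullet> (A *v u) = a * (u \<bullet> u)"
  shows "A *v u = a *\<^sub>R u"
proof -
  define w where "w = a *\<^sub>R u - A *v u"
  define H where "H = a * (w \<bullet> w) - w \<bullet> (A *v w)"
  have wW: "w \<in> W"
    unfolding w_def using W u inv by (intro subspace_diff subspace_scale)
  have expand: "0 \<le> 2 * t * (w \<bullet> w) + t\<^sup>2 * H" for t
  proof -
    have "u + t *\<^sub>R w \<in> W"
      using W u wW by (intro subspace_add subspace_scale)
    from max[OF this] have "0 \<le> a * ((u + t *\<^sub>R w) \<bullet> (u + t *\<^sub>R w))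
        - (u + t *\<^sub>R w) \<bullet> (A *v (u + t *\<^sub>R w))" by simp
    also have "\<dots> = 2 * t * (a * (u \<bullet> w) - (A *v u) \<bullet> w) + t\<^sup>2 * H"
      using eq symmetric_matrix_inner[OF sym, of u w]
      by (simp add: H_def matrix_vector_right_distrib matrix_vector_mult_scaleR
          inner_add_left inner_add_right inner_commute power2_eq_square algebra_simps)
    also have "a * (u \<bullet> w) - (A *v u) \<bullet> w = w \<bullet> w"
      by (simp add: w_def inner_diff_left)
    finally show ?thesis .
  qed
  have H: "H \<ge> 0" using max[OF wW] by (simp add: H_def)
  have "w \<bullet> w = 0"
  proof (rule ccontr)
    assume "w \<bullet> w \<noteq> 0"
    then have N: "w \<bullet> w > 0" by simp
    \<comment> \<open>The minimiser of the quadratic polynomial in \<open>expand\<close>, with \<open>H + 1\<close> for \<open>H\<close> as \<open>H\<close> may be 0.\<close>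
    define t where "t = - (w \<bullet> w) / (H + 1)"
    have "2 * t * (w \<bullet> w) + t\<^sup>2 * H = - ((w \<bullet> w)\<^sup>2 * (H + 2) / (H + 1)\<^sup>2)"
      using H by (simp add: t_def divide_simps power2_eq_square) (simp add: algebra_simps)
    also have "\<dots> < 0"
      using N H by (simp only: neg_less_0_iff_less) (intro divide_pos_pos mult_pos_pos zero_less_power; simp)
    finally show False using expand[of t] by simp
  qed
  then show ?thesis by (simp add: w_def)
qed

text \<open>
  The eigenvectors are indexed by a set of matrix indices, which makes the result the columns of a
  square matrix once \<open>I\<close> is everything. Each new eigenvector maximises the Rayleigh quotient on the
  orthogonal complement of the previous ones, which \<open>A\<close> leaves invariant.
\<close>

lemma symmetric_matrix_orthonormal_eigenvectors:
  fixes A :: "real^'m^'m" and I :: "'m set"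
  assumes sym: "transpose A = A"
  shows "\<exists>q d. (\<forall>i\<in>I. A *v q i = d i *\<^sub>R q i) \<and>
               (\<forall>i\<in>I. \<forall>j\<in>I. q i \<bullet> q j = (if i = j then 1 else 0))"
proof (induction I rule: finite_induct[OF finite])
  case 1
  show ?case by simp
next
  case (2 k I)
  then obtain q d where eig: "\<And>i. i \<in> I \<Longrightarrow> A *v q i = d i *\<^sub>R q i"
    and orth: "\<And>i j. i \<in> I \<Longrightarrow> j \<in> I \<Longrightarrow> q i \<bullet> q j = (if i = j then 1 else 0)"
    by blast
  define W where "W = {x. \<forall>i\<in>I. q i \<bullet> x = 0}"
  have subW: "subspace W"
    by (auto simp: W_def subspace_def inner_add_right)
  have invW: "A *v x \<in> W" if "x \<in> W" for x
    using that by (auto simp: W_def symmetric_matrix_inner[OF sym, symmetric] eig)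
  have "I \<noteq> UNIV" using 2 by auto
  then have "card I < CARD('m)" by (simp add: psubset_card_mono psubset_eq)
  then have "dim (q ` I) < DIM(real^'m)"
    using dim_le_card'[of "q ` I"] card_image_le[of I q] by simp
  then obtain x0 where x0: "x0 \<noteq> 0" "\<And>y. y \<in> span (q ` I) \<Longrightarrow> orthogonal x0 y"
    using orthogonal_to_subspace_exists by blast
  have x0W: "x0 \<in> W"
    using x0(2)[OF span_base] by (auto simp: W_def orthogonal_def inner_commute[of x0])
  define C where "C = sphere 0 1 \<inter> W"
  have "compact C"
    unfolding C_def by (intro compact_Int_closed closed_subspace subW compact_sphere)
  moreover have "x0 /\<^sub>R norm x0 \<in> C"
    using x0(1) x0W subW by (auto simp: C_def intro!: subspace_scale)
  then have "C \<noteq> {}" by blast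
  moreover have "continuous_on C (\<lambda>x. x \<bullet> (A *v x))"
    by (intro continuous_on_inner continuous_intros matrix_vector_mult_linear_continuous_on)
  ultimately obtain u where u: "u \<in> C" "\<And>x. x \<in> C \<Longrightarrow> x \<bullet> (A *v x) \<le> u \<bullet> (A *v u)"
    by (metis continuous_attains_sup)
  define a where "a = u \<bullet> (A *v u)"
  have uW: "u \<in> W" and uu: "u \<bullet> u = 1"
    using u(1) by (auto simp: C_def norm_eq_1)
  have "x \<bullet> (A *v x) \<le> a * (x \<bullet> x)" if x: "x \<in> W" for x
  proof (cases "x = 0")
    case False
    have "x /\<^sub>R norm x \<in> C"
      using x False subW by (auto simp: C_def intro!: subspace_scale)
    from u(2)[OF this] show ?thesis
      using False by (simp add: a_def matrix_vector_mult_scaleR dot_square_norm field_simps power2_eq_square)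
  qed simp
  then have Au: "A *v u = a *\<^sub>R u"
    using uu by (intro rayleigh_maximiser_eigenvector[OF sym subW uW invW[OF uW]]) (auto simp: a_def)
  have "q i \<bullet> u = 0" "u \<bullet> q i = 0" if "i \<in> I" for i
    using that uW by (auto simp: W_def inner_commute)
  then show ?case
    using 2 eig orth Au uu
    by (intro exI[of _ "q(k := u)"] exI[of _ "d(k := a)"]) auto
qed

definition diag_matrix :: "('n \<Rightarrow> real) \<Rightarrow> real^'n^'n"
  where "diag_matrix d = (\<chi> i j. if i = j then d i else 0)"

lemma diag_matrix_mult:
  "diag_matrix c ** diag_matrix d = diag_matrix (\<lambda>i. c i * d i :: real)"
  by (simp add: diag_matrix_def matrix_matrix_mult_def vec_eq_iff if_distrib[of "\<lambda>x. x * _"]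
      cong: if_cong)

lemma mat_eq_diag_matrix: "mat 1 = diag_matrix (\<lambda>i. 1)"
  by (simp add: diag_matrix_def mat_def)

lemma trace_diag_matrix: "trace (diag_matrix d) = sum d UNIV"
  by (simp add: diag_matrix_def trace_def)

lemma spectral_theorem_symmetric_matrix:
  fixes A :: "real^'m^'m"
  assumes sym: "transpose A = A"
  obtains Q :: "real^'m^'m" and d where "transpose Q ** Q = mat 1" "Q ** transpose Q = mat 1"
    "A = Q ** diag_matrix d ** transpose Q"
proof -
  obtain q :: "'m \<Rightarrow> real^'m" and d where eig: "\<And>i. A *v q i = d i *\<^sub>R q i"
    and orth: "\<And>i j. q i \<bullet> q j = (if i = j then 1 else 0)"
    using symmetric_matrix_orthonormal_eigenvectors[OF sym, of UNIV] by blast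
  define Q :: "real^'m^'m" where "Q = (\<chi> i j. q j $ i)"
  have QQ: "transpose Q ** Q = mat 1"
    using orth by (simp add: Q_def vec_eq_iff matrix_matrix_mult_def transpose_def mat_def inner_vec_def)
  then have QQ': "Q ** transpose Q = mat 1" by (simp add: matrix_left_right_inverse)
  have "(A ** Q) $ i $ j = (Q ** diag_matrix d) $ i $ j" for i j
    using arg_cong[OF eig[of j], of "\<lambda>x. x $ i"]
    by (simp add: Q_def matrix_matrix_mult_def matrix_vector_mult_def diag_matrix_def
        if_distrib[of "\<lambda>x. _ * x"] cong: if_cong)
  then have "A ** Q = Q ** diag_matrix d" by (simp add: vec_eq_iff)
  then have "A = Q ** diag_matrix d ** transpose Q"
    by (metis QQ' matrix_mul_assoc matrix_mul_rid)
  then show ?thesis using that QQ QQ' by blast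
qed

text \<open>
  \<open>P\<close> is the orthogonal projection onto the eigenspace of \<open>A\<close> for \<open>a\<close> (which is trivial if \<open>a\<close> is
  no eigenvalue), and \<open>S\<close> is the reduced resolvent, an inverse of \<open>A - a\<close> on the complement of
  that eigenspace. Carrying \<open>S\<close> along replaces any mention of spectral gaps: a bound on
  \<open>\<parallel>S\<parallel>\<close> plays that role in the estimates.
\<close>

definition spectral_projection ::
    "real^'m^'m \<Rightarrow> real \<Rightarrow> real^'m^'m \<Rightarrow> real^'m^'m \<Rightarrow> bool"
  where "spectral_projection A a P S \<longleftrightarrow>
    transpose P = P \<and> A ** P = a *\<^sub>R P \<and> P ** A = a *\<^sub>R P \<and>
    S ** (A - a *\<^sub>R mat 1) = mat 1 - P \<and> (A - a *\<^sub>R mat 1) ** S = mat 1 - P"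

lemma spectral_projection_idem:
  assumes "spectral_projection A a P S"
  shows "P ** P = P"
proof -
  have "S ** ((A - a *\<^sub>R mat 1) ** P) = (mat 1 - P) ** P"
    using assms by (simp add: spectral_projection_def matrix_mul_assoc)
  moreover have "(A - a *\<^sub>R mat 1) ** P = 0"
    using assms by (simp add: spectral_projection_def matrix_algebra)
  ultimately show ?thesis by (simp add: matrix_algebra)
qed

lemma spectral_resolution:
  fixes A :: "real^'m^'m"
  assumes sym: "transpose A = A"
  obtains L P S where "finite L" "A = (\<Sum>a\<in>L. a *\<^sub>R P a)"
    "\<And>a. spectral_projection A a (P a) (S a)"
proof -
  obtain Q :: "real^'m^'m" and d where Q: "transpose Q ** Q = mat 1" "Q ** transpose Q = mat 1"
    and A: "A = Q ** diag_matrix d ** transpose Q"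
    using spectral_theorem_symmetric_matrix[OF sym] by blast
  \<comment> \<open>Functional calculus: \<open>fc c\<close> stands for \<open>f(A)\<close> where \<open>c i = f (d i)\<close>. All identities for \<open>P\<close> and
    \<open>S\<close> then hold because they hold for functions on the spectrum.\<close>
  define fc where "fc c = Q ** diag_matrix c ** transpose Q" for c
  have fc_mult: "fc b ** fc c = fc (\<lambda>i. b i * c i)" for b c
  proof -
    have "fc b ** fc c = Q ** diag_matrix b ** (transpose Q ** Q) ** diag_matrix c ** transpose Q"
      by (simp add: fc_def matrix_mul_assoc)
    also have "\<dots> = Q ** (diag_matrix b ** diag_matrix c) ** transpose Q"
      by (simp only: Q matrix_mul_rid matrix_mul_assoc)
    finally show ?thesis
      by (simp only: fc_def diag_matrix_mult)
  qed
  have fc_add: "fc b + fc c = fc (\<lambda>i. b i + c i)" for b c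
  proof -
    have "diag_matrix (\<lambda>i. b i + c i) = diag_matrix b + diag_matrix c"
      by (simp add: diag_matrix_def vec_eq_iff)
    then show ?thesis by (simp add: fc_def matrix_algebra)
  qed
  have fc_scale: "r *\<^sub>R fc c = fc (\<lambda>i. r * c i)" for r c
  proof -
    have "diag_matrix (\<lambda>i. r * c i) = r *\<^sub>R diag_matrix c"
      by (simp add: diag_matrix_def vec_eq_iff)
    then show ?thesis by (simp add: fc_def matrix_algebra)
  qed
  have fc_diff: "fc b - fc c = fc (\<lambda>i. b i - c i)" for b c
    using fc_add[of b "\<lambda>i. (-1) * c i"] fc_scale[of "-1" c, symmetric] by simp
  have fc_sum: "(\<Sum>a\<in>L. fc (c a)) = fc (\<lambda>i. \<Sum>a\<in>L. c a i)" if "finite L" for L :: "real set" and c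
    using that
  proof induction
    case empty
    show ?case using fc_scale[of 0 "\<lambda>i. 0"] by simp
  next
    case insert
    then show ?case by (simp add: fc_add)
  qed
  have fc_one: "mat 1 = fc (\<lambda>i. 1)"
    by (simp add: fc_def mat_eq_diag_matrix[symmetric] Q)
  have fc_A: "A = fc d" by (simp add: A fc_def)
  have fc_sym: "transpose (fc c) = fc c" for c
  proof -
    have "transpose (diag_matrix c) = diag_matrix c"
      by (auto simp: diag_matrix_def transpose_def vec_eq_iff)
    then show ?thesis by (simp add: fc_def matrix_transpose_mul matrix_mul_assoc)
  qed
  define P where "P a = fc (\<lambda>i. if d i = a then 1 else 0)" for a
  define S where "S a = fc (\<lambda>i. if d i = a then 0 else 1 / (d i - a))" for a
  have "finite (range d)" by simp
  moreover have "A = (\<Sum>a\<in>range d. a *\<^sub>R P a)"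
  proof -
    have "(\<Sum>a\<in>range d. a *\<^sub>R P a) = fc (\<lambda>i. \<Sum>a\<in>range d. if d i = a then a else 0)"
      by (simp add: P_def fc_scale fc_sum if_distrib[of "\<lambda>x. _ * x"] cong: if_cong)
    then show ?thesis by (simp add: fc_A)
  qed
  moreover have "spectral_projection A a (P a) (S a)" for a
    unfolding spectral_projection_def P_def S_def fc_A fc_one fc_mult fc_scale fc_diff fc_sym
    by (intro conjI refl arg_cong[where f = fc] ext; simp)
  ultimately show ?thesis using that by blast
qed

section \<open>Commutators and spectral projections\<close>

definition commutator :: "real^'m^'m \<Rightarrow> real^'m^'m \<Rightarrow> real^'m^'m"
  where "commutator Y Z = Y ** Z - Z ** Y"

lemma norm_commutator_commute: "norm (commutator Y Z) = norm (commutator Z Y)"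
  by (simp add: commutator_def norm_minus_commute)

text \<open>
  Commuting with \<open>A\<close> up to a small error implies commuting with its spectral projections up to a
  comparable error: the off-diagonal parts \<open>P Z (1 - P)\<close> and \<open>(1 - P) Z P\<close> of \<open>Z\<close> are recovered
  from \<open>[A, Z]\<close> by writing \<open>1 - P\<close> as \<open>(A - a) S\<close> or \<open>S (A - a)\<close>.
\<close>

lemma norm_commutator_spectral_projection_le:
  assumes "spectral_projection A a P S"
  shows "norm (commutator P Z) \<le> 2 * norm P * norm S * norm (commutator A Z)"
proof -
  define R where "R = A - a *\<^sub>R mat 1"
  define C where "C = commutator A Z"
  have C: "C = R ** Z - Z ** R"
    by (simp add: C_def R_def commutator_def matrix_algebra)
  have PR: "P ** R = 0" "R ** P = 0" and SR: "S ** R = mat 1 - P" "R ** S = mat 1 - P"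
    using assms by (simp_all add: spectral_projection_def R_def matrix_algebra)
  have "P ** C ** S = (P ** R) ** Z ** S - P ** Z ** (R ** S)"
    by (simp add: C matrix_algebra matrix_mul_assoc)
  then have 1: "P ** C ** S = P ** Z ** P - P ** Z"
    by (simp add: PR SR matrix_algebra)
  have "S ** C ** P = (S ** R) ** Z ** P - S ** Z ** (R ** P)"
    by (simp add: C matrix_algebra matrix_mul_assoc)
  then have 2: "S ** C ** P = Z ** P - P ** Z ** P"
    by (simp add: PR SR matrix_algebra)
  have "commutator P Z = - (P ** C ** S + S ** C ** P)"
    unfolding 1 2 commutator_def by simp
  then have "norm (commutator P Z) \<le> norm (P ** C ** S) + norm (S ** C ** P)"
    by (simp only: norm_minus_cancel norm_triangle_ineq)
  also have "\<dots> \<le> norm P * norm C * norm S + norm S * norm C * norm P"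
    by (intro add_mono norm_matrix_mult3_le)
  finally show ?thesis by (simp add: C_def mult_ac)
qed

lemma trace_mult_transpose: "trace (Y ** transpose Y) = (norm Y)\<^sup>2"
  for Y :: "real^'n^'m"
  by (metis inner_eq_trace dot_square_norm norm_transpose transpose_transpose)

text \<open>
  The compression \<open>M = N P N\<close> has eigenvalues \<open>d\<^sub>i\<close> with \<open>\<Sum> d\<^sub>i = tr (N P)\<close>. Its idempotency
  defect is \<open>M - M\<^sup>2 = Y Y\<^sup>T\<close> where \<open>Y = N P (1 - N)\<close> is the off-diagonal part of \<open>P\<close>, and
  \<open>[P, N] = Y\<^sup>T - Y\<close>. Thus all \<open>d\<^sub>i\<close> lie in \<open>[0, 1]\<close>, and rounding each of them to 0 or 1 costs at
  most \<open>2 (d\<^sub>i - d\<^sub>i\<^sup>2)\<close>, which sums to \<open>2 \<parallel>Y\<parallel>\<^sup>2 = \<parallel>[P, N]\<parallel>\<^sup>2\<close>.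
\<close>

lemma projections_trace_near_integer:
  fixes P N :: "real^'m^'m"
  assumes P: "transpose P = P" "P ** P = P" and N: "transpose N = N" "N ** N = N"
  shows "\<exists>r::int. \<bar>trace (N ** P) - r\<bar> \<le> (norm (commutator P N))\<^sup>2"
proof -
  define M where "M = N ** P ** N"
  define Y where "Y = N ** P - M"
  have PP: "Z ** P ** P = Z ** P" and NN: "Z ** N ** N = Z ** N" for Z :: "real^'m^'m"
    using P N by (simp_all add: matrix_mul_assoc[symmetric])
  have symM: "transpose M = M"
    by (simp add: M_def matrix_algebra P N matrix_mul_assoc)
  have YT: "transpose Y = P ** N - M"
    by (simp add: Y_def matrix_algebra P N symM)
  have YYT: "Y ** transpose Y = M - M ** M"
    unfolding YT by (simp add: Y_def M_def matrix_algebra matrix_mul_assoc PP NN P N)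
  have YY: "Y ** Y = 0"
    by (simp add: Y_def M_def matrix_algebra matrix_mul_assoc PP NN P N)
  have trM: "trace M = trace (N ** P)"
    by (simp add: M_def trace_mul_sym[of "N ** P"] matrix_mul_assoc N)
  have "(norm (commutator P N))\<^sup>2 = (norm (transpose Y - Y))\<^sup>2"
    by (simp add: commutator_def YT) (simp add: Y_def)
  also have "\<dots> = 2 * (norm Y)\<^sup>2 - 2 * (transpose Y \<bullet> Y)"
    by (simp add: power2_norm_eq_inner inner_diff_left inner_diff_right inner_commute)
      (simp add: power2_norm_eq_inner[symmetric] norm_transpose)
  also have "transpose Y \<bullet> Y = trace (Y ** Y)"
    by (simp add: inner_eq_trace)
  also have "\<dots> = 0"
    by (simp add: YY trace_def)
  finally have commutator: "(norm (commutator P N))\<^sup>2 = 2 * trace (M - M ** M)"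
    by (simp add: trace_mult_transpose[symmetric] YYT)
  obtain Q :: "real^'m^'m" and d where Q: "transpose Q ** Q = mat 1" "Q ** transpose Q = mat 1"
    and M: "M = Q ** diag_matrix d ** transpose Q"
    by (rule spectral_theorem_symmetric_matrix[OF symM])
  have QM: "transpose Q ** M = diag_matrix d ** transpose Q"
    by (simp add: M matrix_mul_assoc Q)
  have diagM: "transpose Q ** M ** Q = diag_matrix d"
    unfolding QM by (simp add: matrix_mul_assoc[symmetric] Q)
  have diagMM: "transpose Q ** (M ** M) ** Q = diag_matrix (\<lambda>i. d i * d i)"
  proof -
    have "transpose Q ** (M ** M) ** Q = (transpose Q ** M) ** M ** Q"
      by (simp only: matrix_mul_assoc)
    also have "\<dots> = diag_matrix d ** (transpose Q ** M ** Q)"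
      by (subst QM) (simp only: matrix_mul_assoc)
    finally show ?thesis by (simp add: diagM diag_matrix_mult)
  qed
  have trace_conj: "trace (transpose Q ** Z ** Q) = trace Z" for Z
    by (simp add: trace_mul_sym[of _ Q] matrix_mul_assoc Q)
  have sum_d: "trace M = sum d UNIV"
    using trace_conj[of M] by (simp add: diagM trace_diag_matrix)
  have sum_dd: "trace (M - M ** M) = (\<Sum>i\<in>UNIV. d i - d i * d i)"
    using trace_conj[of "M ** M"]
    by (simp add: sum_d trace_sub diagMM trace_diag_matrix sum_subtractf)
  have nonneg: "0 \<le> d i - d i * d i" for i
  proof -
    have "(transpose Q ** Y) ** transpose (transpose Q ** Y)
        = diag_matrix d - diag_matrix (\<lambda>i. d i * d i)"
      by (simp add: matrix_transpose_mul matrix_mul_assoc[symmetric])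
        (simp add: matrix_mul_assoc YYT[unfolded matrix_mul_assoc] matrix_algebra diagM[symmetric]
          diagMM[symmetric])
    then have "d i - d i * d i = ((transpose Q ** Y) ** transpose (transpose Q ** Y)) $ i $ i"
      by (simp add: diag_matrix_def)
    also have "\<dots> = (\<Sum>k\<in>UNIV. ((transpose Q ** Y) $ i $ k)\<^sup>2)"
      by (simp add: matrix_matrix_mult_def[of "transpose Q ** Y"] transpose_def[of "_ ** Y"] power2_eq_square)
    also have "\<dots> \<ge> 0" by (simp add: sum_nonneg)
    finally show ?thesis .
  qed
  define e :: "'m \<Rightarrow> real" where "e i = (if d i \<ge> 1/2 then 1 else 0)" for i
  have round: "\<bar>d i - e i\<bar> \<le> 2 * (d i - d i * d i)" for i
  proof -
    have d: "0 \<le> d i * (1 - d i)" using nonneg[of i] by (simp add: algebra_simps)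
    then have "0 \<le> d i" "d i \<le> 1" by (auto simp: zero_le_mult_iff)
    then have "0 \<le> (2 * d i - 1) * (1 - d i)" if "d i \<ge> 1/2"
      using that by (intro mult_nonneg_nonneg) auto
    moreover have "0 \<le> d i * (1 - 2 * d i)" if "\<not> d i \<ge> 1/2"
      using that \<open>0 \<le> d i\<close> by (intro mult_nonneg_nonneg) auto
    ultimately show ?thesis
      using \<open>0 \<le> d i\<close> \<open>d i \<le> 1\<close> by (auto simp: e_def algebra_simps)
  qed
  have e: "sum e UNIV = of_int (int (card {i. d i \<ge> 1/2}))"
    by (simp add: e_def[abs_def] sum.If_cases)
  have "\<bar>sum d UNIV - sum e UNIV\<bar> \<le> (\<Sum>i\<in>UNIV. \<bar>d i - e i\<bar>)"
    unfolding sum_subtractf[symmetric] by (rule sum_abs)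
  also have "\<dots> \<le> (\<Sum>i\<in>UNIV. 2 * (d i - d i * d i))"
    by (intro sum_mono round)
  also have "\<dots> = (norm (commutator P N))\<^sup>2"
    unfolding commutator sum_dd by (simp add: sum_distrib_left)
  finally show ?thesis
    unfolding sum_d[symmetric] trM e by blast
qed

section \<open>Conjugation by a point of the Stiefel manifold\<close>

lemma stiefel_cancel: "X \<in> stiefel \<Longrightarrow> transpose X ** (X ** Z) = Z"
  by (simp add: stiefel_def matrix_mul_assoc)

lemma norm_stiefel:
  fixes X :: "real^'n^'m"
  assumes "X \<in> stiefel"
  shows "norm X = sqrt CARD('n)"
  using assms by (simp add: norm_eq_sqrt_inner inner_eq_trace stiefel_def trace_I)

lemma norm_sandwich_stiefel_le:
  fixes X :: "real^'n^'m"
  assumes "X \<in> stiefel"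
  shows "norm (X ** Z ** transpose X) \<le> CARD('n) * norm Z"
  using norm_matrix_mult3_le[of X Z "transpose X"]
  by (simp add: norm_transpose norm_stiefel[OF assms] mult_ac)

text \<open>
  On the range of \<open>X\<close> the matrix \<open>X B X\<^sup>T\<close> is a copy of \<open>B\<close>, and on the orthogonal complement it
  is 0. There the resolvent at \<open>b\<close> is \<open>- 1 / b\<close>, so only nonzero eigenvalues of \<open>B\<close> carry over;
  for \<open>b = 0\<close> the eigenspace of \<open>X B X\<^sup>T\<close> would also contain that complement.
\<close>

lemma spectral_projection_stiefel:
  fixes X :: "real^'n^'m"
  assumes X: "X \<in> stiefel" and B: "spectral_projection B b V T" and b: "b \<noteq> 0"
  shows "spectral_projection (X ** B ** transpose X) b (X ** V ** transpose X)
           (X ** T ** transpose X - (1 / b) *\<^sub>R (mat 1 - X ** transpose X))"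
proof -
  have BV: "B ** V = b *\<^sub>R V" "V ** B = b *\<^sub>R V" "transpose V = V"
    and TB: "T ** B = mat 1 - V + b *\<^sub>R T" "B ** T = mat 1 - V + b *\<^sub>R T"
    using B by (simp_all add: spectral_projection_def matrix_algebra algebra_simps)
  \<comment> \<open>The same identities multiplied by \<open>X\<^sup>T\<close>, to rewrite inside right-nested products.\<close>
  have lift: "B ** (V ** transpose X) = b *\<^sub>R (V ** transpose X)"
    "V ** (B ** transpose X) = b *\<^sub>R (V ** transpose X)"
    "T ** (B ** transpose X) = transpose X - V ** transpose X + b *\<^sub>R (T ** transpose X)"
    "B ** (T ** transpose X) = transpose X - V ** transpose X + b *\<^sub>R (T ** transpose X)"
    unfolding matrix_mul_assoc BV TB by (simp_all add: matrix_algebra)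
  have XX: "transpose X ** X = mat 1" using X by (simp add: stiefel_def)
  show ?thesis
    unfolding spectral_projection_def using b
    by (simp add: matrix_algebra BV matrix_mul_assoc[symmetric] stiefel_cancel[OF X] XX lift
        algebra_simps)
qed

lemma inner_sandwich_eq_trace:
  fixes X :: "real^'n^'m"
  shows "X \<bullet> (P ** X ** V) = trace (P ** (X ** V ** transpose X))"
  by (metis inner_eq_trace matrix_mul_assoc trace_mul_sym)

text \<open>
  The commutator estimate is used twice, for the spectral projection \<open>P\<close> of \<open>A\<close> and for the
  spectral projection \<open>X V X\<^sup>T\<close> of \<open>X B X\<^sup>T\<close>; the reduced resolvent of the latter is bounded
  uniformly in \<open>X\<close>, which makes the constant independent of \<open>X\<close>.
\<close>

lemma spectral_weight_near_integer:
  fixes A :: "real^'m^'m" and B :: "real^'n^'n"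
  assumes A: "spectral_projection A a P S" and B: "spectral_projection B b V T" and b: "b \<noteq> 0"
  shows "\<exists>c\<ge>0. \<forall>X\<in>stiefel. \<exists>r::int. \<bar>X \<bullet> (P ** X ** V) - r\<bar>
           \<le> c * (norm (commutator A (X ** B ** transpose X)))\<^sup>2"
proof -
  \<comment> \<open>\<open>k\<close> bounds the reduced resolvent of \<open>X B X\<^sup>T\<close> at \<open>b\<close>.\<close>
  define k where "k = CARD('n) * norm T + (1 / \<bar>b\<bar>) * (norm (mat 1 :: real^'m^'m) + CARD('n))"
  define c where "c = (2 * (CARD('n) * norm V) * k) * (2 * norm P * norm S)"
  have k: "0 \<le> k" by (simp add: k_def)
  have "\<exists>r::int. \<bar>X \<bullet> (P ** X ** V) - r\<bar> \<le> c\<^sup>2 * (norm (commutator A (X ** B ** transpose X)))\<^sup>2"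
    if X: "X \<in> stiefel" for X :: "real^'n^'m"
  proof -
    define K where "K = X ** B ** transpose X"
    define W where "W = X ** V ** transpose X"
    define U where "U = X ** T ** transpose X - (1 / b) *\<^sub>R (mat 1 - X ** transpose X)"
    have sp: "spectral_projection K b W U"
      unfolding K_def W_def U_def by (rule spectral_projection_stiefel[OF X B b])
    have W: "norm W \<le> CARD('n) * norm V"
      unfolding W_def by (rule norm_sandwich_stiefel_le[OF X])
    have "norm (X ** transpose X) \<le> CARD('n)"
      using norm_matrix_mult_le[of X "transpose X"] by (simp add: norm_transpose norm_stiefel[OF X])
    then have "norm (mat 1 - X ** transpose X) \<le> norm (mat 1 :: real^'m^'m) + CARD('n)"
      by (meson norm_triangle_ineq4 add_left_mono order_trans)
    then have "norm ((1 / b) *\<^sub>R (mat 1 - X ** transpose X))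
        \<le> (1 / \<bar>b\<bar>) * (norm (mat 1 :: real^'m^'m) + CARD('n))"
      by (simp add: divide_right_mono)
    then have U: "norm U \<le> k"
      unfolding U_def k_def
      by (meson norm_triangle_ineq4 add_mono norm_sandwich_stiefel_le[OF X] order_trans)
    have "norm (commutator W P) \<le> 2 * norm W * norm U * norm (commutator P K)"
      using norm_commutator_spectral_projection_le[OF sp, of P] norm_commutator_commute[of K P] by simp
    also have "\<dots> \<le> 2 * (CARD('n) * norm V) * k * (2 * norm P * norm S * norm (commutator A K))"
      using W U k by (intro mult_mono norm_commutator_spectral_projection_le[OF A]) auto
    finally have "norm (commutator W P) \<le> c * norm (commutator A K)"
      by (simp add: c_def mult_ac)
    then have "(norm (commutator W P))\<^sup>2 \<le> c\<^sup>2 * (norm (commutator A K))\<^sup>2"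
      by (metis norm_ge_zero power_mono power_mult_distrib)
    moreover have "\<exists>r::int. \<bar>trace (P ** W) - r\<bar> \<le> (norm (commutator W P))\<^sup>2"
      using sp A by (intro projections_trace_near_integer)
        (auto simp: spectral_projection_def intro: spectral_projection_idem)
    ultimately show ?thesis
      unfolding inner_sandwich_eq_trace K_def W_def by (meson order_trans)
  qed
  then show ?thesis by (intro exI[of _ "c\<^sup>2"]) auto
qed

section \<open>The residual controls the commutator\<close>

text \<open>
  With the Euclidean gradient \<open>G = 2 A X B\<close> one has \<open>2 [A, X B X\<^sup>T] = G X\<^sup>T - X G\<^sup>T\<close>. The part of
  \<open>D\<close> along the range of \<open>X\<close> is \<open>X\<^sup>T D = 2 \<rho> (X\<^sup>T G - G\<^sup>T X)\<close>, and the part orthogonal to it is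
  \<open>E = (1 - X X\<^sup>T) G\<close>. Together they determine \<open>G X\<^sup>T - X G\<^sup>T\<close> linearly, with a factor \<open>1 / \<rho>\<close>.
\<close>

lemma norm_commutator_le_D_map:
  fixes A :: "real^'m^'m" and B :: "real^'n^'n" and \<rho> :: real
  assumes A: "transpose A = A" and B: "transpose B = B" and \<rho>: "\<rho> > 0"
  shows "\<exists>c\<ge>0. \<forall>X\<in>stiefel. norm (commutator A (X ** B ** transpose X))
           \<le> c * norm (D_map (quad_trace A B) \<rho> X)"
proof -
  define s where "s = sqrt (real CARD('n))"
  have s: "0 \<le> s" by (simp add: s_def)
  define c where "c = (s * s * s + 4 * \<rho> * ((1 + s * s) * s)) / (4 * \<rho>)"
  have "norm (commutator A (X ** B ** transpose X)) \<le> c * norm (D_map (quad_trace A B) \<rho> X)"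
    if X: "X \<in> stiefel" for X :: "real^'n^'m"
  proof -
    define G where "G = 2 *\<^sub>R (A ** X ** B)"
    define D where "D = D_map (quad_trace A B) \<rho> X"
    define E where "E = D - X ** (transpose X ** D)"
    have nX: "norm X = s" "norm (transpose X) = s"
      by (simp_all add: norm_transpose norm_stiefel[OF X] s_def)
    have D: "D = G - X ** ((2 * \<rho>) *\<^sub>R (transpose G ** X) + (1 - 2 * \<rho>) *\<^sub>R (transpose X ** G))"
      by (simp add: D_def D_map_def euclidean_grad_quad_trace[OF A B] G_def)
    have XD: "transpose X ** D = (2 * \<rho>) *\<^sub>R (transpose X ** G - transpose G ** X)"
      unfolding D by (simp add: matrix_algebra stiefel_cancel[OF X] algebra_simps)
    have E: "E = G - X ** (transpose X ** G)"
      unfolding E_def XD unfolding D by (simp add: matrix_algebra algebra_simps)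
    have comm: "2 *\<^sub>R commutator A (X ** B ** transpose X) = G ** transpose X - X ** transpose G"
      by (simp add: commutator_def G_def matrix_algebra A B matrix_mul_assoc algebra_simps)
    have "(4 * \<rho>) *\<^sub>R commutator A (X ** B ** transpose X)
        = (2 * \<rho>) *\<^sub>R (G ** transpose X - X ** transpose G)"
      unfolding comm[symmetric] by simp
    also have "\<dots> = X ** (transpose X ** D) ** transpose X
           + (2 * \<rho>) *\<^sub>R (E ** transpose X - X ** transpose E)"
      unfolding XD E by (simp add: matrix_algebra matrix_mul_assoc algebra_simps)
    finally have eq: "4 * \<rho> * norm (commutator A (X ** B ** transpose X))
        = norm (X ** (transpose X ** D) ** transpose X
           + (2 * \<rho>) *\<^sub>R (E ** transpose X - X ** transpose E))"
      using \<rho> by (metis abs_of_pos mult_pos_pos norm_scaleR zero_less_numeral)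
    have normE: "norm E \<le> (1 + s * s) * norm D"
    proof -
      have "norm (X ** (transpose X ** D)) \<le> s * (s * norm D)"
        using norm_matrix_mult_le[of X "transpose X ** D"] norm_matrix_mult_le[of "transpose X" D] s
        by (simp add: nX) (meson mult_left_mono order_trans)
      then show ?thesis
        using norm_triangle_ineq4[of D "X ** (transpose X ** D)"]
        by (simp add: E_def algebra_simps)
    qed
    have skew: "norm (E ** transpose X - X ** transpose E) \<le> norm E * s + s * norm E"
      using norm_matrix_mult_le[of E "transpose X"] norm_matrix_mult_le[of X "transpose E"]
      by (intro order_trans[OF norm_triangle_ineq4] add_mono) (simp_all add: nX norm_transpose)
    note eq
    also have "norm (X ** (transpose X ** D) ** transpose X
           + (2 * \<rho>) *\<^sub>R (E ** transpose X - X ** transpose E))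
        \<le> norm (X ** (transpose X ** D) ** transpose X)
        + 2 * \<rho> * norm (E ** transpose X - X ** transpose E)"
      using \<rho> by (intro order_trans[OF norm_triangle_ineq]) simp
    also have "norm (X ** (transpose X ** D) ** transpose X) \<le> s * (s * norm D) * s"
      using norm_matrix_mult3_le[of X "transpose X ** D" "transpose X"]
        norm_matrix_mult_le[of "transpose X" D] s
      by (simp add: nX) (meson mult_left_mono mult_right_mono order_trans)
    also have "norm (E ** transpose X - X ** transpose E) \<le> 2 * ((1 + s * s) * norm D * s)"
      using skew mult_right_mono[OF normE s] by (simp add: algebra_simps)
    finally show ?thesis
      using s \<rho> by (simp add: c_def D_def field_simps)
  qed
  moreover have "0 \<le> c" using s \<rho> by (simp add: c_def)
  ultimately show ?thesis by blast
qed

text \<open>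
  With \<open>C = X\<^sup>T A X\<close>, the component \<open>X\<^sup>T grad F(X) = C B - B C\<close> shows that \<open>B\<close> and \<open>C\<close> commute; what
  is left of the equation \<open>grad F(X) = 0\<close> is \<open>A X B = X C B\<close>. Hence \<open>A (X B X\<^sup>T) = X C B X\<^sup>T\<close>, which
  is symmetric.
\<close>

lemma commutator_critical_point:
  fixes A :: "real^'m^'m" and B :: "real^'n^'n"
  assumes A: "transpose A = A" and B: "transpose B = B" and X: "X \<in> critical_points (quad_trace A B)"
  shows "commutator A (X ** B ** transpose X) = 0"
proof -
  define C where "C = transpose X ** (A ** X)"
  have X: "X \<in> stiefel" and "stiefel_grad (quad_trace A B) X = 0"
    using X by (simp_all add: critical_points_def)
  then have grad: "2 *\<^sub>R (A ** X ** B) - X ** (C ** B) - X ** (B ** C) = 0"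
    by (simp add: stiefel_grad_quad_trace[OF A B] C_def matrix_mul_assoc)
  have "transpose X ** (2 *\<^sub>R (A ** X ** B) - X ** (C ** B) - X ** (B ** C)) = C ** B - B ** C"
    by (simp only: matrix_mult_diff matrix_mult_scaleR stiefel_cancel[OF X])
      (simp add: C_def matrix_mul_assoc scaleR_2)
  then have CB: "C ** B = B ** C"
    unfolding grad by simp
  have "2 *\<^sub>R (A ** X ** B) = 2 *\<^sub>R (X ** (C ** B))"
    using grad unfolding CB scaleR_2[of "X ** (B ** C)"] by (simp only: diff_diff_eq right_minus_eq)
  then have AXB: "A ** X ** B = X ** (C ** B)" by simp
  have symC: "transpose C = C"
    by (simp add: C_def matrix_transpose_mul A matrix_mul_assoc)
  have "B ** transpose X ** A = transpose (A ** X ** B)"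
    by (simp add: matrix_transpose_mul A B matrix_mul_assoc)
  also have "\<dots> = C ** B ** transpose X"
    unfolding AXB by (simp add: matrix_transpose_mul symC B CB)
  finally have BXA: "B ** transpose X ** A = C ** B ** transpose X" .
  have "commutator A (X ** B ** transpose X)
      = (A ** X ** B) ** transpose X - X ** (B ** transpose X ** A)"
    by (simp add: commutator_def matrix_mul_assoc)
  then show ?thesis
    unfolding AXB BXA by (simp add: matrix_mul_assoc)
qed

section \<open>Local square bounds\<close>

text \<open>
  The inequality to be proved, in squared form and for an arbitrary function \<open>f\<close> and residual \<open>g\<close>.
  Stating it as a property of \<open>f\<close> lets it be checked on the summands of a linear combination.
\<close>

definition locally_square_bounded ::
    "'a::real_normed_vector set \<Rightarrow> 'a set \<Rightarrow> ('a \<Rightarrow> real) \<Rightarrow> ('a \<Rightarrow> real) \<Rightarrow> bool"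
  where "locally_square_bounded S C g f \<longleftrightarrow>
    (\<exists>\<delta>>0. \<exists>c\<ge>0. \<forall>x\<in>S. \<forall>y\<in>C. norm (x - y) \<le> \<delta> \<longrightarrow> \<bar>f x - f y\<bar> \<le> c * (g x)\<^sup>2)"

lemma locally_square_bounded_const: "locally_square_bounded S C g (\<lambda>x. k)"
  unfolding locally_square_bounded_def by (intro exI[of _ 1] exI[of _ 0] conjI) auto

lemma locally_square_bounded_scale:
  assumes "locally_square_bounded S C g f"
  shows "locally_square_bounded S C g (\<lambda>x. r * f x)"
proof -
  obtain \<delta> c where "\<delta> > 0" "c \<ge> 0"
    and f: "\<And>x y. x \<in> S \<Longrightarrow> y \<in> C \<Longrightarrow> norm (x - y) \<le> \<delta> \<Longrightarrow> \<bar>f x - f y\<bar> \<le> c * (g x)\<^sup>2"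
    using assms unfolding locally_square_bounded_def by blast
  have "\<bar>r * f x - r * f y\<bar> \<le> \<bar>r\<bar> * c * (g x)\<^sup>2" if "x \<in> S" "y \<in> C" "norm (x - y) \<le> \<delta>" for x y
    using mult_left_mono[OF f[OF that], of "\<bar>r\<bar>"]
    by (simp add: abs_mult[symmetric] right_diff_distrib mult.assoc)
  then show ?thesis
    unfolding locally_square_bounded_def using \<open>\<delta> > 0\<close> \<open>c \<ge> 0\<close>
    by (intro exI[of _ \<delta>] conjI exI[of _ "\<bar>r\<bar> * c"]) auto
qed

lemma locally_square_bounded_add:
  assumes "locally_square_bounded S C g f" "locally_square_bounded S C g h"
  shows "locally_square_bounded S C g (\<lambda>x. f x + h x)"
proof -
  obtain \<delta> c where "\<delta> > 0" "c \<ge> 0"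
    and f: "\<And>x y. x \<in> S \<Longrightarrow> y \<in> C \<Longrightarrow> norm (x - y) \<le> \<delta> \<Longrightarrow> \<bar>f x - f y\<bar> \<le> c * (g x)\<^sup>2"
    using assms(1) unfolding locally_square_bounded_def by blast
  obtain \<epsilon> d where "\<epsilon> > 0" "d \<ge> 0"
    and h: "\<And>x y. x \<in> S \<Longrightarrow> y \<in> C \<Longrightarrow> norm (x - y) \<le> \<epsilon> \<Longrightarrow> \<bar>h x - h y\<bar> \<le> d * (g x)\<^sup>2"
    using assms(2) unfolding locally_square_bounded_def by blast
  have "\<bar>(f x + h x) - (f y + h y)\<bar> \<le> (c + d) * (g x)\<^sup>2"
    if "x \<in> S" "y \<in> C" "norm (x - y) \<le> min \<delta> \<epsilon>" for x y
    using f[of x y] h[of x y] that by (simp add: distrib_right)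
  then show ?thesis
    unfolding locally_square_bounded_def using \<open>\<delta> > 0\<close> \<open>c \<ge> 0\<close> \<open>\<epsilon> > 0\<close> \<open>d \<ge> 0\<close>
    by (intro exI[of _ "min \<delta> \<epsilon>"] conjI exI[of _ "c + d"]) auto
qed

lemma locally_square_bounded_sum:
  assumes "finite I" "\<And>i. i \<in> I \<Longrightarrow> locally_square_bounded S C g (f i)"
  shows "locally_square_bounded S C g (\<lambda>x. \<Sum>i\<in>I. f i x)"
  using assms
  by (induction I rule: finite_induct)
    (auto intro: locally_square_bounded_const locally_square_bounded_add)

text \<open>
  If \<open>r \<noteq> v\<close>, then \<open>r\<close> and \<open>v\<close> are at distance at least 1, and \<open>u\<close> is at least as far from \<open>r\<close>
  as from \<open>v\<close>.
\<close>

lemma abs_diff_le_of_near_integer: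
  fixes u v e :: real and r :: int
  assumes "v \<in> \<int>" "\<bar>u - v\<bar> \<le> 1/2" "\<bar>u - r\<bar> \<le> e"
  shows "\<bar>u - v\<bar> \<le> e"
proof -
  obtain k where k: "v = of_int k" using assms(1) by (auto elim: Ints_cases)
  show ?thesis
  proof (cases "k = r")
    case False
    then have "1 \<le> \<bar>k - r\<bar>" by simp
    then have "1 \<le> \<bar>v - real_of_int r\<bar>" unfolding k by linarith
    then show ?thesis using assms by linarith
  qed (use assms k in simp)
qed

lemma locally_square_bounded_of_near_integer:
  assumes lip: "\<And>x y. x \<in> S \<Longrightarrow> y \<in> C \<Longrightarrow> \<bar>f x - f y\<bar> \<le> l * norm (x - y)"
    and near: "\<And>x. x \<in> S \<Longrightarrow> \<exists>r::int. \<bar>f x - r\<bar> \<le> c * (g x)\<^sup>2"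
    and int: "\<And>y. y \<in> C \<Longrightarrow> f y \<in> \<int>" and c: "c \<ge> 0"
  shows "locally_square_bounded S C g f"
proof -
  define \<delta> where "\<delta> = 1 / (2 * (\<bar>l\<bar> + 1))"
  have \<delta>: "\<delta> > 0" by (simp add: \<delta>_def)
  have "\<bar>f x - f y\<bar> \<le> c * (g x)\<^sup>2" if x: "x \<in> S" and y: "y \<in> C" and xy: "norm (x - y) \<le> \<delta>" for x y
  proof -
    have "\<bar>f x - f y\<bar> \<le> l * norm (x - y)" by (rule lip[OF x y])
    also have "\<dots> \<le> (\<bar>l\<bar> + 1) * \<delta>"
      using xy by (intro mult_mono) auto
    also have "\<dots> = 1/2" by (simp add: \<delta>_def field_simps)
    finally show ?thesis
      using near[OF x] int[OF y] abs_diff_le_of_near_integer by blast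
  qed
  then show ?thesis
    unfolding locally_square_bounded_def using \<delta> c by blast
qed

text \<open>
  The form is quadratic in \<open>X\<close>, hence Lipschitz on the Stiefel manifold, which lies in the sphere of
  radius \<open>\<surd>n\<close>.
\<close>

lemma sandwich_form_lipschitz:
  fixes X Y :: "real^'n^'m"
  assumes X: "X \<in> stiefel" and Y: "Y \<in> stiefel"
  shows "\<bar>X \<bullet> (P ** X ** V) - Y \<bullet> (P ** Y ** V)\<bar>
    \<le> (2 * sqrt CARD('n) * norm P * norm V) * norm (X - Y)"
proof -
  have bound: "\<bar>U \<bullet> (P ** Z ** V)\<bar> \<le> norm U * (norm P * norm Z * norm V)" for U Z :: "real^'n^'m"
    by (meson Cauchy_Schwarz_ineq2 mult_left_mono norm_ge_zero norm_matrix_mult3_le order_trans)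
  have "X \<bullet> (P ** X ** V) - Y \<bullet> (P ** Y ** V)
      = (X - Y) \<bullet> (P ** X ** V) + Y \<bullet> (P ** (X - Y) ** V)"
    by (simp add: matrix_algebra inner_diff_left inner_diff_right)
  then show ?thesis
    using bound[of "X - Y" X] bound[of Y "X - Y"]
    by (simp add: norm_stiefel[OF X] norm_stiefel[OF Y] mult_ac)
qed

lemma spectral_weight_locally_square_bounded:
  fixes A :: "real^'m^'m" and B :: "real^'n^'n"
  assumes A: "transpose A = A" and B: "transpose B = B" and \<rho>: "\<rho> > 0"
    and P: "spectral_projection A a P S" and V: "spectral_projection B b V T" and b: "b \<noteq> 0"
  shows "locally_square_bounded stiefel (critical_points (quad_trace A B))
    (\<lambda>X. norm (D_map (quad_trace A B) \<rho> X)) (\<lambda>X. X \<bullet> (P ** X ** V))"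
proof -
  obtain c where c: "c \<ge> 0" and near: "\<And>X. X \<in> stiefel \<Longrightarrow> \<exists>r::int. \<bar>X \<bullet> (P ** X ** V) - r\<bar>
           \<le> c * (norm (commutator A (X ** B ** transpose X)))\<^sup>2"
    using spectral_weight_near_integer[OF P V b] by blast
  obtain d where d: "d \<ge> 0" and comm: "\<And>X. X \<in> stiefel \<Longrightarrow>
      norm (commutator A (X ** B ** transpose X)) \<le> d * norm (D_map (quad_trace A B) \<rho> X)"
    using norm_commutator_le_D_map[OF A B \<rho>] by blast
  show ?thesis
  proof (rule locally_square_bounded_of_near_integer)
    show "\<bar>X \<bullet> (P ** X ** V) - Y \<bullet> (P ** Y ** V)\<bar>
        \<le> (2 * sqrt CARD('n) * norm P * norm V) * norm (X - Y)"
      if "X \<in> stiefel" "Y \<in> critical_points (quad_trace A B)" for X Y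
      using that by (intro sandwich_form_lipschitz) (auto simp: critical_points_def)
    show "\<exists>r::int. \<bar>X \<bullet> (P ** X ** V) - r\<bar> \<le> (c * d\<^sup>2) * (norm (D_map (quad_trace A B) \<rho> X))\<^sup>2"
      if "X \<in> stiefel" for X
    proof -
      have "(norm (commutator A (X ** B ** transpose X)))\<^sup>2
          \<le> d\<^sup>2 * (norm (D_map (quad_trace A B) \<rho> X))\<^sup>2"
        unfolding power_mult_distrib[symmetric] by (intro power_mono comm[OF that]) simp
      then have "c * (norm (commutator A (X ** B ** transpose X)))\<^sup>2
          \<le> (c * d\<^sup>2) * (norm (D_map (quad_trace A B) \<rho> X))\<^sup>2"
        using c by (simp add: mult.assoc mult_left_mono)
      then show ?thesis using near[OF that] by (meson order_trans)
    qed
    show "Y \<bullet> (P ** Y ** V) \<in> \<int>" if Y: "Y \<in> critical_points (quad_trace A B)" for Y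
    proof -
      have "Y \<in> stiefel" using Y by (simp add: critical_points_def)
      from near[OF this] show ?thesis
        by (auto simp: commutator_critical_point[OF A B Y])
    qed
    show "0 \<le> c * d\<^sup>2" using c by simp
  qed
qed

section \<open>The error bound for the quadratic trace function\<close>

lemma quad_trace_eq_inner: "quad_trace A B X = X \<bullet> (A ** X ** B)"
  by (simp add: quad_trace_def inner_eq_trace matrix_mul_assoc)

lemma matrix_mult_sum_left: "(\<Sum>i\<in>I. F i) ** Y = (\<Sum>i\<in>I. F i ** Y)"
  for F :: "_ \<Rightarrow> real^'k^'m" and Y :: "real^'n^'k"
  by (induction I rule: infinite_finite_induct) (simp_all add: matrix_mult_add)

lemma matrix_mult_sum_right: "Y ** (\<Sum>i\<in>I. F i) = (\<Sum>i\<in>I. Y ** F i)"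
  for F :: "_ \<Rightarrow> real^'n^'k" and Y :: "real^'k^'m"
  by (induction I rule: infinite_finite_induct) (simp_all add: matrix_mult_add)

theorem theorem1:
  fixes A :: "real^'m^'m" and B :: "real^'n^'n" and \<rho> :: real
  assumes "CARD('n) \<le> CARD('m)"
    and "transpose A = A" and "transpose B = B"
    and "\<rho> > 0"
  shows "\<exists>\<delta> \<eta>. \<delta> > 0 \<and> \<eta> > 0 \<and>
    (\<forall>X \<in> (stiefel :: (real^'n^'m) set). \<forall>X' \<in> critical_points (quad_trace A B).
      norm (X - X') \<le> \<delta> \<longrightarrow>
      sqrt \<bar>quad_trace A B X - quad_trace A B X'\<bar> \<le> \<eta> * norm (D_map (quad_trace A B) \<rho> X))"
proof -
  obtain L P S where L: "finite L" and AL: "A = (\<Sum>a\<in>L. a *\<^sub>R P a)"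
    and P: "\<And>a. spectral_projection A a (P a) (S a)"
    using spectral_resolution[OF assms(2)] by metis
  obtain M V T where M: "finite M" and BM: "B = (\<Sum>b\<in>M. b *\<^sub>R V b)"
    and V: "\<And>b. spectral_projection B b (V b) (T b)"
    using spectral_resolution[OF assms(3)] by metis
  let ?D = "D_map (quad_trace A B) \<rho> :: real^'n^'m \<Rightarrow> _"
  have expand: "quad_trace A B X = (\<Sum>a\<in>L. \<Sum>b\<in>M. (a * b) * (X \<bullet> (P a ** X ** V b)))"
    for X :: "real^'n^'m"
    unfolding quad_trace_eq_inner
    by (subst AL, subst BM)
      (simp add: matrix_mult_sum_left matrix_mult_sum_right matrix_mult_scaleR inner_sum_right
        sum_distrib_left mult_ac, subst sum.swap, simp add: mult_ac)
  have "locally_square_bounded stiefel (critical_points (quad_trace A B)) (\<lambda>X. norm (?D X))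
      (\<lambda>X. (a * b) * (X \<bullet> (P a ** X ** V b)))" for a b
  proof (cases "b = 0")
    case True
    \<comment> \<open>The weight itself need not be near an integer here, but its coefficient vanishes.\<close>
    then show ?thesis by (simp add: locally_square_bounded_const)
  next
    case False
    then show ?thesis
      using spectral_weight_locally_square_bounded[OF assms(2-4) P V False]
      by (intro locally_square_bounded_scale)
  qed
  then have "locally_square_bounded stiefel (critical_points (quad_trace A B)) (\<lambda>X. norm (?D X))
      (\<lambda>X. quad_trace A B X)"
    unfolding expand by (intro locally_square_bounded_sum L M)
  then obtain \<delta> c where \<delta>: "\<delta> > 0" and c: "c \<ge> 0"
    and bound: "\<And>X X'. X \<in> stiefel \<Longrightarrow> X' \<in> critical_points (quad_trace A B) \<Longrightarrow> norm (X - X') \<le> \<delta>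
      \<Longrightarrow> \<bar>quad_trace A B X - quad_trace A B X'\<bar> \<le> c * (norm (?D X))\<^sup>2"
    unfolding locally_square_bounded_def by blast
  \<comment> \<open>\<open>sqrt c + 1\<close> and not \<open>sqrt c\<close>, since \<open>c\<close> may be 0.\<close>
  have "sqrt \<bar>quad_trace A B X - quad_trace A B X'\<bar> \<le> (sqrt c + 1) * norm (?D X)"
    if "X \<in> stiefel" "X' \<in> critical_points (quad_trace A B)" "norm (X - X') \<le> \<delta>" for X X'
  proof -
    have "sqrt \<bar>quad_trace A B X - quad_trace A B X'\<bar> \<le> sqrt (c * (norm (?D X))\<^sup>2)"
      by (intro real_sqrt_le_mono bound[OF that])
    also have "\<dots> = sqrt c * norm (?D X)"
      by (simp add: real_sqrt_mult)
    also have "\<dots> \<le> (sqrt c + 1) * norm (?D X)"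
      by (intro mult_right_mono) auto
    finally show ?thesis .
  qed
  moreover have "sqrt c + 1 > 0"
    using c by (simp add: add_nonneg_pos)
  ultimately show ?thesis
    using \<delta> by blast
qed

end
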